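(* For any integer $n\geq 1$, $$N_{n}(t)=\left(\frac{1+yt}{1+y}\right)^{n+1}D_{n}^{(\mathrm{hk},\mathrm{pk})}\left(\frac{(1+y)^{2}t}{(y+t)(1+yt)},\frac{y+t}{1+yt}\right).$$ Equivalently, $$D_{n}^{(\mathrm{hk},\mathrm{pk})}(y,t)=\left(\frac{1+u}{1+uv}\right)^{n+1}N_{n}(v),$$ where $$u=\frac{1+t^{2}-2yt-(1-t)\sqrt{(1+t)^{2}-4yt}}{2(1-y)t},\qquad v=\frac{(1+t)^{2}-2yt-(1+t)\sqrt{(1+t)^{2}-4yt}}{2yt}.$$ Furthermore, $$D_{n}^{(\mathrm{hk},\mathrm{pk})}(y,t)=\sum_{k=0}^{\lfloor (n-1)/2\rfloor}\frac{1}{k+1}\binom{2k}{k}\binom{n-1}{2k}y^{k+1}t^{k+1}(1+t)^{n-2k-1},$$ and the number of Dyck paths of semilength $n$ with $k$ hooks and $j$ peaks is $$\frac{1}{k+1}\binom{2k}{k}\binom{n-1}{2k}\binom{n-2k-1}{j-k-1}.$$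
   Context: A Dyck path of semilength $n$ is a lattice path from $(0,0)$ to $(2n,0)$ consisting of up steps $U=(1,1)$ and down steps $D=(1,-1)$ that never goes below the $x$-axis; it is encoded by its Dyck word in the letters $U,D$. $\mathcal{D}_n$ is the set of Dyck paths of semilength $n$. For a Dyck path $\mu$, a peak is an occurrence of the consecutive subword $UD$ and a hook is an occurrence of the consecutive subword $DDU$ in its Dyck word; $\mathrm{pk}(\mu)$ and $\mathrm{hk}(\mu)$ are the numbers of peaks and hooks of $\mu$. For $n\ge1$, $D_n^{(\mathrm{hk},\mathrm{pk})}(y,t)=\sum_{\mu\in\mathcal{D}_n}y^{\mathrm{hk}(\mu)+1}t^{\mathrm{pk}(\mu)}$, and the $n$th Narayana polynomial is $N_n(t)=\frac1n\sum_{k=1}^n\binom nk\binom n{k-1}t^k$. Binomial coefficients $\binom ab$ are $0$ when $b<0$ or when $0\le a<b$. Here $y,t$ are indeterminates; the first identity is an identity of rational functions in $y,t$. In the second identity, $\sqrt{(1+t)^2-4yt}$ is the formal power series in $t$ over $\mathbb{Q}[y]$ with constant term $1$, so that $u$ and $v$ are formal power series in $t$ with coefficients in $\mathbb{Q}[y]$. *)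

theory Defs
  imports "HOL-Computational_Algebra.Computational_Algebra"
begin

datatype step = Up | Down

fun rise :: "step \<Rightarrow> int" where
  "rise Up = 1"
| "rise Down = -1"

definition height :: "step list \<Rightarrow> int" where
  "height w = (\<Sum>s\<leftarrow>w. rise s)"

definition dyck_paths :: "nat \<Rightarrow> step list set" where
  "dyck_paths n = {w. length w = 2 * n \<and> height w = 0 \<and> (\<forall>i \<le> 2 * n. 0 \<le> height (take i w))}"

definition occurrences :: "'a list \<Rightarrow> 'a list \<Rightarrow> nat" where
  "occurrences p w = card {i. i + length p \<le> length w \<and> take (length p) (drop i w) = p}"

definition pk :: "step list \<Rightarrow> nat" where
  "pk w = occurrences [Up, Down] w"

definition hk :: "step list \<Rightarrow> nat" where
  "hk w = occurrences [Down, Down, Up] w"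

lemma finite_dyck_paths: "finite (dyck_paths n)"
proof -
  have "(UNIV :: step set) = {Up, Down}"
    using step.exhaust by blast
  then have "finite (UNIV :: step set)"
    by (metis finite.emptyI finite.insertI)
  then have "finite {w :: step list. set w \<subseteq> UNIV \<and> length w = 2 * n}"
    by (rule finite_lists_length_eq)
  then show ?thesis
    by (rule rev_finite_subset) (auto simp: dyck_paths_def)
qed

text \<open>
  Both polynomials are given by their values at elements of a ring or field, so that evaluating them
  at indeterminates gives the polynomials themselves and evaluating them elsewhere is substitution.
\<close>

definition dyck_poly :: "nat \<Rightarrow> 'a::comm_ring_1 \<Rightarrow> 'a \<Rightarrow> 'a" where
  "dyck_poly n y t = (\<Sum>\<mu>\<in>dyck_paths n. y ^ (hk \<mu> + 1) * t ^ pk \<mu>)"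

definition narayana_poly :: "nat \<Rightarrow> 'a::field \<Rightarrow> 'a" where
  "narayana_poly n t =
    1 / of_nat n * (\<Sum>k = 1..n. of_nat (n choose k) * of_nat (n choose (k - 1)) * t ^ k)"

text \<open>
  Binomial coefficients with integer arguments, zero when the lower argument is negative.  They
  vanish for \<open>0 \<le> a < b\<close>, as the generalised binomial coefficient does.
\<close>

definition binom :: "int \<Rightarrow> int \<Rightarrow> rat" where
  "binom a b = (if b < 0 then 0 else of_int a gchoose nat b)"

lemma binom_of_nat: "binom (int a) (int b) = of_nat (a choose b)"
  by (simp add: binom_def binomial_gbinomial)

text \<open>The field \<open>\<rat>(y, t)\<close> is the fraction field of \<open>\<rat>[y][t]\<close>.\<close>

definition rat_y :: "rat poly poly fract" where
  "rat_y = to_fract [:[:0, 1:]:]"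

definition rat_t :: "rat poly poly fract" where
  "rat_t = to_fract [:0, 1:]"

text \<open>
  The quotients defining \<open>u\<close> and \<open>v\<close> are formed in the fraction field of \<open>\<rat>[y][[t]]\<close>.
  The power series themselves are the range of \<^const>\<open>to_fract\<close>.
\<close>

definition ser_y :: "rat poly fps fract" where
  "ser_y = to_fract (fps_const [:0, 1:])"

definition ser_t :: "rat poly fps fract" where
  "ser_t = to_fract fps_X"

definition sqrt_series :: "rat poly fps" where
  "sqrt_series = (THE s. s ^ 2 = (1 + fps_X) ^ 2 - 4 * fps_const [:0, 1:] * fps_X \<and> fps_nth s 0 = 1)"

definition ser_sqrt :: "rat poly fps fract" where
  "ser_sqrt = to_fract sqrt_series"

definition ser_u :: "rat poly fps fract" where
  "ser_u = (1 + ser_t ^ 2 - 2 * ser_y * ser_t - (1 - ser_t) * ser_sqrt) / (2 * (1 - ser_y) * ser_t)"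

definition ser_v :: "rat poly fps fract" where
  "ser_v = ((1 + ser_t) ^ 2 - 2 * ser_y * ser_t - (1 + ser_t) * ser_sqrt) / (2 * ser_y * ser_t)"

lemma sqrt_series_exists_unique:
  "\<exists>!s :: rat poly fps. s ^ 2 = (1 + fps_X) ^ 2 - 4 * fps_const [:0, 1:] * fps_X \<and> fps_nth s 0 = 1"
proof (rule ex_ex1I)
  define B :: "rat fps" where "B = fps_binomial (1 / 2)"
  define C :: "rat poly fps" where "C = Abs_fps (\<lambda>m. [:fps_nth B m:])"
  define z :: "rat poly fps" where "z = (1 + fps_X) ^ 2 - 4 * fps_const [:0, 1:] * fps_X - 1"
  have z0: "fps_nth z 0 = 0"
    by (simp add: z_def power2_eq_square)
  have BB: "B * B = 1 + fps_X"
    by (simp add: B_def fps_binomial_add_mult [symmetric] fps_binomial_1)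
  have CC: "C * C = 1 + fps_X"
  proof (rule fps_ext)
    fix m
    have sum_pconst: "(\<Sum>i\<in>I. [:f i:]) = [:\<Sum>i\<in>I. f i:]" for I :: "nat set" and f :: "nat \<Rightarrow> rat"
      by (induction I rule: infinite_finite_induct) auto
    have "fps_nth (C * C) m = [:fps_nth (B * B) m:]"
      by (simp add: C_def fps_mult_nth sum_pconst mult.commute)
    also have "\<dots> = fps_nth (1 + fps_X) m"
      by (auto simp: BB fps_X_nth one_pCons)
    finally show "fps_nth (C * C) m = fps_nth (1 + fps_X) m" .
  qed
  have "(C oo z) ^ 2 = (C * C) oo z"
    using z0 by (simp add: power2_eq_square fps_compose_mult_distrib)
  also have "\<dots> = 1 + z"
    using z0 by (simp add: CC fps_compose_add_distrib)
  finally have "(C oo z) ^ 2 = (1 + fps_X) ^ 2 - 4 * fps_const [:0, 1:] * fps_X"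
    by (simp add: z_def)
  moreover have "fps_nth (C oo z) 0 = 1"
    by (simp add: C_def B_def one_pCons)
  ultimately show "\<exists>s :: rat poly fps.
      s ^ 2 = (1 + fps_X) ^ 2 - 4 * fps_const [:0, 1:] * fps_X \<and> fps_nth s 0 = 1"
    by blast
next
  fix r s :: "rat poly fps"
  assume r: "r ^ 2 = (1 + fps_X) ^ 2 - 4 * fps_const [:0, 1:] * fps_X \<and> fps_nth r 0 = 1"
    and s: "s ^ 2 = (1 + fps_X) ^ 2 - 4 * fps_const [:0, 1:] * fps_X \<and> fps_nth s 0 = 1"
  then have "r = s \<or> r = - s"
    by (metis power2_eq_iff)
  moreover have "r \<noteq> - s"
  proof
    assume "r = - s"
    then have "fps_nth r 0 = - fps_nth s 0" by simp
    with r s show False by (simp add: one_pCons)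
  qed
  ultimately show "r = s" by blast
qed

end

theory Submission
  imports Defs
begin

text \<open>
  The first-return decomposition \<open>\<mu> = U a D b\<close> creates a new peak exactly when \<open>a\<close> is empty and a new
  hook exactly when neither \<open>a\<close> nor \<open>b\<close> is empty.  Hence the generating function \<open>G\<close> of the polynomials
  \<open>D\<^sub>n(y, t)\<close> satisfies \<open>G = X (y t + (1 + t) G + G\<^sup>2)\<close>, which is solved in terms of the Catalan series
  and yields \<open>D\<^sub>n\<close> as a polynomial \<open>M\<^sub>n(a, b)\<close> in \<open>a = y t\<close> and \<open>b = 1 + t\<close>.  By Vandermonde convolution
  \<open>N\<^sub>n(x) = M\<^sub>n(x, 1 + x)\<close>.  Since \<open>M\<^sub>n(c\<^sup>2 a, c b) = c\<^bsup>n + 1\<^esup> M\<^sub>n(a, b)\<close>, the first two identities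
  only require \<open>c\<close> and \<open>x\<close> with \<open>y t = c\<^sup>2 x\<close> and \<open>1 + t = c (1 + x)\<close>.
\<close>

section \<open>Catalan numbers and the quadratic functional equation\<close>

text \<open>The formulas below are proved over fields of characteristic 0; these instances make them
  applicable in both fraction fields of the theorem.\<close>

instance fract :: ("{idom, ring_char_0}") ring_char_0
proof
  have "of_nat n = to_fract (of_nat n :: 'a)" for n by (induction n) auto
  then show "inj (of_nat :: nat \<Rightarrow> 'a fract)" by (auto intro!: injI)
qed

instance fract :: ("{idom, ring_char_0}") field_char_0 ..

instance fps :: (ring_char_0) ring_char_0 ..

definition catalan :: "nat \<Rightarrow> 'a::field_char_0" where
  "catalan k = 1 / of_nat (k + 1) * of_nat ((2 * k) choose k)"

lemma catalan_0 [simp]: "catalan 0 = 1"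
  by (simp add: catalan_def)

text \<open>Two absorptions reduce binom(2k+2, k+1) to binom(2k, k). The recurrence drives the
  induction in \<open>gbinomial_half\<close>.\<close>

lemma catalan_Suc:
  "of_nat (k + 2) * (catalan (Suc k) :: 'a::field_char_0) = of_nat (4 * k + 2) * catalan k"
proof -
  have "Suc k * (2 * Suc k choose Suc k) = 2 * Suc k * (2 * k + 1 choose k)"
    using Suc_times_binomial [of k "2 * k + 1"] by simp
  moreover have "Suc k * (2 * k + 1 choose k) = (2 * k + 1) * (2 * k choose k)"
    using Suc_times_binomial [of k "2 * k"] binomial_symmetric [of k "2 * k + 1"] by simp
  ultimately have "Suc k * (2 * Suc k choose Suc k) = (4 * k + 2) * (2 * k choose k)"
    by (simp add: mult.assoc del: binomial_Suc_Suc)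
  then have "of_nat (Suc k) * of_nat (2 * Suc k choose Suc k) =
      (of_nat (4 * k + 2) * of_nat (2 * k choose k) :: 'a)"
    by (simp only: of_nat_mult [symmetric])
  moreover have "(of_nat (k + 2) :: 'a) \<noteq> 0" "(of_nat (Suc k) :: 'a) \<noteq> 0"
    unfolding of_nat_eq_0_iff by auto
  moreover have "m * (1 / m * x) = p * (1 / l * z)"
    if "l * x = p * z" "m \<noteq> 0" "l \<noteq> 0" for m x l p z :: 'a
    using that by (simp add: field_simps)
  ultimately have "of_nat (k + 2) * (1 / of_nat (k + 2) * of_nat (2 * Suc k choose Suc k)) =
      (of_nat (4 * k + 2) * (1 / of_nat (Suc k) * of_nat (2 * k choose k)) :: 'a)"
    by blast
  moreover have "Suc k + 1 = k + 2" "k + 1 = Suc k" by auto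
  ultimately show ?thesis
    by (simp only: catalan_def)
qed

text \<open>Both sides gain the factor (4k+2)/(k+2) when k increases by 1: absorption contributes
  (1/2 - (k+1))/(k+2), and (1/2 - (k+1)) times -4 is 4k+2.\<close>

lemma gbinomial_half: "((1/2) gchoose Suc k) * (-4) ^ Suc k = (-2 * catalan k :: 'a::field_char_0)"
proof (induction k)
  case (Suc k)
  have nz: "(of_nat (Suc (Suc k)) :: 'a) \<noteq> 0"
    unfolding of_nat_eq_0_iff by simp
  have "of_nat (Suc (Suc k)) * ((1/2 :: 'a) gchoose Suc (Suc k)) =
      (1/2 - of_nat (Suc k)) * ((1/2) gchoose Suc k)"
    using gbinomial_absorb_comp[of "1/2::'a" "Suc k"] gbinomial_absorption'[of "Suc (Suc k)" "1/2::'a"]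
    by (metis gbinomial_absorption)
  moreover have "m * (g * (c * p)) = s * c * (h * p)" if "m * g = s * h" for m g c p s h :: 'a
    using that by (simp add: mult_ac)
  ultimately have "of_nat (Suc (Suc k)) * (((1/2 :: 'a) gchoose Suc (Suc k)) * (-4) ^ Suc (Suc k)) =
      (1/2 - of_nat (Suc k)) * (-4) * (((1/2) gchoose Suc k) * (-4) ^ Suc k)"
    unfolding power_Suc [of "-4 :: 'a" "Suc k"] by blast
  also have "\<dots> = (1/2 - of_nat (Suc k)) * (-4) * (-2 * catalan k)"
    by (simp only: Suc.IH)
  also have "\<dots> = -2 * (of_nat (4 * k + 2) * catalan k)"
    by (simp add: algebra_simps)
  also have "\<dots> = of_nat (Suc (Suc k)) * (-2 * catalan (Suc k))"
    unfolding catalan_Suc [symmetric] by simp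
  finally show ?case
    using nz by (metis mult_left_cancel)
qed simp

text \<open>The coefficients of \<open>S = (1 - 4X)\<^bsup>1/2\<^esup>\<close> give \<open>S = 1 - 2 X C\<close>, and \<open>S\<^sup>2 = 1 - 4X\<close> is the equation of \<open>C\<close>.\<close>

lemma fps_catalan:
  fixes C :: "'a::field_char_0 fps"
  defines "C \<equiv> Abs_fps catalan"
  shows "C = 1 + fps_X * C ^ 2"
proof -
  define S :: "'a fps" where "S = Abs_fps (\<lambda>n. ((1/2) gchoose n) * (-4) ^ n)"
  have "S * S = 1 - 4 * fps_X"
  proof (rule fps_ext)
    fix n
    have "(S * S) $ n = (\<Sum>i=0..n. ((1/2) gchoose i) * ((1/2) gchoose (n - i))) * (-4) ^ n"
      unfolding fps_mult_nth S_def sum_distrib_right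
      by (intro sum.cong refl)
        (simp add: mult.assoc mult.left_commute flip: power_add)
    also have "\<dots> = (1 gchoose n) * (-4) ^ n"
      using gbinomial_Vandermonde [of "1/2 :: 'a" "1/2" n] by (simp add: atLeast0AtMost)
    also have "\<dots> = (1 - 4 * fps_X :: 'a fps) $ n"
    proof -
      have "(1 :: 'a) gchoose n = of_nat (1 choose n)"
        using binomial_gbinomial [of 1 n, where 'a = 'a] by simp
      then show ?thesis
        by (cases "n = 0 \<or> n = 1") (auto simp: numeral_fps_const)
    qed
    finally show "(S * S) $ n = (1 - 4 * fps_X :: 'a fps) $ n" .
  qed
  moreover have "S = 1 - 2 * fps_X * C"
  proof (rule fps_ext)
    fix n
    show "S $ n = (1 - 2 * fps_X * C) $ n"
    proof (cases n)
      case (Suc k)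
      then show ?thesis
        using gbinomial_half [of k, where 'a = 'a]
        by (simp add: S_def C_def mult.assoc numeral_fps_const)
    qed (simp add: S_def mult.assoc)
  qed
  ultimately have "(1 - 2 * fps_X * C) * (1 - 2 * fps_X * C) = 1 - 4 * fps_X" by simp
  then have "4 * fps_X * C = 4 * fps_X * (1 + fps_X * C ^ 2)"
    by (simp add: algebra_simps power2_eq_square)
  then show ?thesis
    by simp
qed

text \<open>Since \<open>w\<close> has no constant term, \<open>w ^ i\<close> has no coefficients
  below i; hence all inner sums may run up to the common bound \<open>n\<close> and the summations
  can be exchanged.\<close>

lemma fps_mult_compose_nth:
  fixes q c w :: "'a::idom fps"
  assumes "w $ 0 = 0"
  shows "(q * (c oo w)) $ n = (\<Sum>i\<le>n. c $ i * (q * w ^ i) $ n)"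
proof -
  have "(q * (c oo w)) $ n = (\<Sum>j=0..n. q $ j * (\<Sum>i\<le>n. c $ i * (w ^ i) $ (n - j)))"
    unfolding fps_mult_nth fps_compose_nth
    using startsby_zero_power_prefix [OF assms]
    by (intro sum.cong refl arg_cong2 [where f = times] sum.mono_neutral_left) auto
  also have "\<dots> = (\<Sum>i\<le>n. c $ i * (q * w ^ i) $ n)"
    unfolding fps_mult_nth sum_distrib_left
    by (subst sum.swap) (simp add: mult_ac)
  finally show ?thesis .
qed

text \<open>Moving the linear term to the left gives d G = X (a + G^2) with d = 1 - b X. For q = a X
  / d and w = a X^2 / d^2 one has q^2 = a w, so the equation of the Catalan series C, taken at w,
  shows that q C(w) is a solution.\<close>

lemma quadratic_fps_nth:
  fixes G :: "'a::field_char_0 fps"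
  assumes G: "G = fps_X * (fps_const a + fps_const b * G + G ^ 2)" and "n \<ge> 1"
  shows "G $ n = (\<Sum>k\<le>n. catalan k * of_nat ((n - 1) choose (2 * k)) * a ^ (k + 1) * b ^ (n - 1 - 2 * k))"
proof -
  define C :: "'a fps" where "C = Abs_fps catalan"
  define d where "d = 1 - fps_const b * fps_X"
  define g where "g = inverse d"
  define w where "w = fps_const a * fps_X ^ 2 * g ^ 2"
  define q where "q = fps_const a * fps_X * g"
  define K where "K = q * (C oo w)"
  have dg: "d * g = 1"
    unfolding g_def by (subst mult.commute, rule inverse_mult_eq_1) (simp add: d_def)
  have w0: "w $ 0 = 0"
    by (simp add: w_def power2_eq_square)
  have "C oo w = (1 + fps_X * C ^ 2) oo w"
    using fps_catalan [where 'a = 'a] by (simp add: C_def)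
  also have "\<dots> = 1 + w * (C oo w) ^ 2"
    using w0 by (simp add: fps_compose_add_distrib fps_compose_mult_distrib fps_compose_power)
  finally have Cw: "C oo w = 1 + w * (C oo w) ^ 2" .
  have "d * K = (d * g) * fps_const a * fps_X * (C oo w)"
    by (simp add: K_def q_def mult_ac)
  also have "\<dots> = fps_const a * fps_X * (1 + w * (C oo w) ^ 2)"
    using dg Cw by simp
  also have "\<dots> = fps_X * (fps_const a + K ^ 2)"
    by (simp add: K_def q_def w_def algebra_simps power2_eq_square)
  finally have K: "K = fps_X * (fps_const a + fps_const b * K + K ^ 2)"
    by (simp add: d_def algebra_simps)
  \<comment> \<open>Uniqueness: the difference of the two equations is a multiple of G - K whose
    cofactor has constant term 1.\<close>
  have "(G - K) * (1 - fps_X * (fps_const b + G + K)) =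
      (G - fps_X * (fps_const a + fps_const b * G + G ^ 2)) -
      (K - fps_X * (fps_const a + fps_const b * K + K ^ 2))"
    by (simp add: algebra_simps power2_eq_square)
  also have "\<dots> = 0"
    using G K by simp
  finally have "(G - K) * (1 - fps_X * (fps_const b + G + K)) = 0" .
  moreover have "1 - fps_X * (fps_const b + G + K) \<noteq> 0"
  proof
    assume "1 - fps_X * (fps_const b + G + K) = 0"
    then have "(1 - fps_X * (fps_const b + G + K)) $ 0 = 0" by simp
    then show False by simp
  qed
  ultimately have "G = K" by simp
  also have "K $ n = (\<Sum>k\<le>n. catalan k * (q * w ^ k) $ n)"
    unfolding K_def by (subst fps_mult_compose_nth [OF w0]) (simp add: C_def)
  also have "\<dots> = (\<Sum>k\<le>n. catalan k * of_nat ((n - 1) choose (2 * k)) * a ^ (k + 1) * b ^ (n - 1 - 2 * k))"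
  proof (intro sum.cong refl)
    fix k
    \<comment> \<open>Separating the powers of X from those of 1/d leaves a negative binomial
      series.\<close>
    have "q * w ^ k = fps_const (a ^ (k + 1)) * (fps_X ^ (2 * k + 1) * g ^ (2 * k + 1))"
    proof -
      have "q = fps_const a * (fps_X * g)" "w = fps_const a * (fps_X * g) ^ 2"
        by (simp_all add: q_def w_def power_mult_distrib mult_ac)
      then have "q * w ^ k = fps_const a ^ (k + 1) * (fps_X * g) ^ (2 * k + 1)"
        by (simp add: power_mult_distrib power_add mult_ac flip: power_mult)
      then show ?thesis
        by (simp only: power_mult_distrib fps_const_power)
    qed
    moreover have "g ^ (2 * k + 1) = Abs_fps (\<lambda>m. of_nat ((2 * k + m) choose m) * b ^ m)"
      unfolding g_def d_def fps_inverse_power [symmetric]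
      by (subst one_minus_const_fps_X_neg_power') auto
    ultimately have *: "(q * w ^ k) $ n = a ^ (k + 1) * (if n < 2 * k + 1 then 0
        else of_nat ((2 * k + (n - (2 * k + 1))) choose (n - (2 * k + 1))) * b ^ (n - (2 * k + 1)))"
      by (simp only: fps_mult_left_const_nth fps_X_power_mult_nth fps_nth_Abs_fps)
    show "catalan k * (q * w ^ k) $ n =
        catalan k * of_nat ((n - 1) choose (2 * k)) * a ^ (k + 1) * b ^ (n - 1 - 2 * k)"
    \<comment> \<open>For 2k >= n the exponent of \<open>b\<close> is truncated to 0, but the
      binomial coefficient vanishes there.\<close>
    proof (cases "n < 2 * k + 1")
      case True
      then have "(n - 1) choose (2 * k) = 0"
        using \<open>n \<ge> 1\<close> by (intro binomial_eq_0) auto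
      then show ?thesis using * True by simp
    next
      case False
      then have "2 * k + (n - (2 * k + 1)) = n - 1" "n - (2 * k + 1) = (n - 1) - 2 * k" "2 * k \<le> n - 1"
        by auto
      moreover from this have "(n - 1) choose ((n - 1) - 2 * k) = (n - 1) choose (2 * k)"
        using binomial_symmetric [of "2 * k" "n - 1"] by simp
      ultimately show ?thesis using * False by simp
    qed
  qed
  finally show ?thesis .
qed

section \<open>First-return decomposition\<close>

text \<open>Membership in \<open>dyck_paths\<close> freed from the semilength, so that factors of a
  path can be treated on their own. Leaving \<open>i\<close> unbounded changes nothing, as
  \<open>take\<close> returns the whole word beyond its length.\<close>

definition dyck :: "step list \<Rightarrow> bool" where
  "dyck w \<longleftrightarrow> height w = 0 \<and> (\<forall>i. 0 \<le> height (take i w))"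

lemma height_simps [simp]:
  "height [] = 0" "height (x # w) = rise x + height w" "height (v @ w) = height v + height w"
  by (simp_all add: height_def)

lemma dyck_paths_iff: "w \<in> dyck_paths n \<longleftrightarrow> dyck w \<and> length w = 2 * n"
  unfolding dyck_paths_def dyck_def
  by (auto, metis nat_le_linear order_refl take_all)

lemma dyck_Nil [simp]: "dyck []"
  by (simp add: dyck_def)

lemma dyck_prefix_ge: "dyck w \<Longrightarrow> w = u @ v \<Longrightarrow> height u \<ge> 0"
  unfolding dyck_def by (metis append_eq_conv_conj)

lemma dyck_hd:
  assumes "dyck w"
  shows "w = [] \<or> hd w = Up"
proof (cases w)
  case (Cons x v)
  then have "height [x] \<ge> 0"
    using dyck_prefix_ge [OF assms, of "[x]" v] by simp
  with Cons show ?thesis by (cases x) auto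
qed simp

lemma dyck_last:
  assumes "dyck w"
  shows "w = [] \<or> last w = Down"
proof (rule ccontr)
  assume *: "\<not> (w = [] \<or> last w = Down)"
  then obtain v where v: "w = v @ [Up]"
    by (metis (full_types) append_butlast_last_id step.exhaust)
  then have "height v \<ge> 0" "height w = 0"
    using dyck_prefix_ge [OF assms v] assms by (simp_all add: dyck_def)
  with v show False by simp
qed

lemma even_length_iff_even_height: "even (length w) \<longleftrightarrow> even (height w)"
proof (induction w)
  case (Cons x w)
  then show ?case by (cases x) auto
qed simp

lemma dyck_even_length: "dyck w \<Longrightarrow> even (length w)"
  by (simp add: even_length_iff_even_height dyck_def)

definition first_return :: "step list \<Rightarrow> step list \<Rightarrow> step list" where
  "first_return a b = Up # a @ Down # b"

lemma dyck_first_return: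
  assumes a: "dyck a" and b: "dyck b"
  shows "dyck (first_return a b)"
  unfolding dyck_def
proof
  show "height (first_return a b) = 0"
    using a b by (simp add: first_return_def dyck_def)
  show "\<forall>i. 0 \<le> height (take i (first_return a b))"
  proof
    fix i
    have ge: "0 \<le> height (take j a)" "0 \<le> height (take j b)" "height a = 0" for j
      using a b by (auto simp: dyck_def)
    show "0 \<le> height (take i (first_return a b))"
    proof (cases i)
      case (Suc j)
      show ?thesis
      \<comment> \<open>A prefix ending no later than \<open>a\<close> lies one level above a prefix
        of \<open>a\<close>; a longer one has returned to the axis and continues along
        \<open>b\<close>.\<close>
      proof (cases "j \<le> length a")
        case True
        with Suc ge show ?thesis by (simp add: first_return_def add_nonneg_nonneg)
      next
        case False
        then obtain m where "j = length a + Suc m"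
          by (metis less_iff_Suc_add not_le add_Suc_right)
        with Suc ge show ?thesis by (simp add: first_return_def)
      qed
    qed simp
  qed
qed

text \<open>After the initial up step, the shortest prefix of negative height ends with a down step
  taken from relative height 0. That step is the first return to the axis, and the word is cut
  there.\<close>

lemma first_return_exists:
  assumes "dyck w" "w \<noteq> []"
  obtains a b where "dyck a" "dyck b" "w = first_return a b"
proof -
  obtain w' where w: "w = Up # w'"
    using assms dyck_hd by (metis list.collapse)
  have hw': "height w' < 0"
    using assms w by (simp add: dyck_def)
  define k where "k = (LEAST k. height (take k w') < 0)"
  have k: "height (take k w') < 0"
    unfolding k_def by (rule LeastI [of _ "length w'"]) (use hw' in simp)
  have less_k: "height (take i w') \<ge> 0" if "i < k" for i
    using not_less_Least [of i "\<lambda>k. height (take k w') < 0"] that by (simp add: k_def)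
  obtain m where m: "k = Suc m"
    using k by (cases k) auto
  have "m < length w'"
  proof (rule ccontr)
    assume "\<not> m < length w'"
    then have "take k w' = take m w'" using m by simp
    then show False using k less_k [of m] m by simp
  qed
  then have tk: "take k w' = take m w' @ [w' ! m]" and w': "w' = take m w' @ w' ! m # drop k w'"
    using m by (simp_all add: take_Suc_conv_app_nth Cons_nth_drop_Suc)
  have "height (take m w') \<ge> 0" using less_k m by simp
  with k tk have wm: "w' ! m = Down" and hm: "height (take m w') = 0"
    by (cases "w' ! m"; simp)+
  define a b where "a = take m w'" and "b = drop k w'"
  have wab: "w = first_return a b"
    using w w' wm by (simp add: first_return_def a_def b_def)
  have "dyck a"
    using hm less_k m unfolding a_def dyck_def by (auto simp: min_def)
  moreover have "dyck b"
    unfolding dyck_def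
  proof
    show "height b = 0"
      using assms(1) wab hm by (simp add: dyck_def first_return_def a_def)
    show "\<forall>i. 0 \<le> height (take i b)"
    proof
      fix i
      have "height (Up # a @ Down # take i b) \<ge> 0"
        using dyck_prefix_ge [OF assms(1), of "Up # a @ Down # take i b" "drop i b"] wab
        by (simp add: first_return_def)
      then show "0 \<le> height (take i b)" using hm by (simp add: a_def)
    qed
  qed
  ultimately show thesis using wab that by blast
qed

text \<open>If one of \<open>a\<close>, \<open>a'\<close> were a proper prefix of the other, the
  longer would have a prefix consisting of the shorter and a down step, of height -1.\<close>

lemma dyck_append_Down_inject:
  assumes "dyck a" "dyck a'" "a @ Down # b = a' @ Down # b'"
  shows "a = a' \<and> b = b'"
proof -
  have *: "us = []"
    if eq: "us @ Down # d = Down # d'" and c: "dyck (c' @ us)" "dyck c'"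
    for us c' and d d' :: "step list"
  proof (cases us)
    case (Cons x us')
    then have "height (c' @ [Down]) \<ge> 0"
      using dyck_prefix_ge [OF c(1), of "c' @ [Down]" us'] eq by simp
    then show ?thesis using c(2) by (simp add: dyck_def)
  qed
  from assms(3) show ?thesis
    unfolding append_eq_append_conv2
  proof (elim exE disjE conjE)
    fix us
    assume "a = a' @ us" "us @ Down # b = Down # b'"
    with * [of us b b' a'] assms(1,2) show ?thesis by simp
  next
    fix us
    assume "a @ us = a'" "Down # b = us @ Down # b'"
    with * [of us b' b a] assms(1,2) show ?thesis by simp
  qed
qed

text \<open>Indexing by the semilength \<open>i\<close> of the inner factor turns sums over paths
  into convolutions. Surjectivity uses that Dyck words have even length.\<close>

lemma bij_betw_first_return:
  "bij_betw (\<lambda>(i, a, b). first_return a b)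
     (SIGMA i:{..n}. dyck_paths i \<times> dyck_paths (n - i)) (dyck_paths (Suc n))"
  unfolding bij_betw_def
proof
  show "inj_on (\<lambda>(i, a, b). first_return a b) (SIGMA i:{..n}. dyck_paths i \<times> dyck_paths (n - i))"
  proof (rule inj_onI)
    fix p q
    assume pq: "p \<in> (SIGMA i:{..n}. dyck_paths i \<times> dyck_paths (n - i))"
      "q \<in> (SIGMA i:{..n}. dyck_paths i \<times> dyck_paths (n - i))"
      "(\<lambda>(i, a, b). first_return a b) p = (\<lambda>(i, a, b). first_return a b) q"
    obtain i a b i' a' b' where [simp]: "p = (i, a, b)" "q = (i', a', b')"
      by (cases p, cases q)
    show "p = q"
      using pq dyck_append_Down_inject [of a a' b b'] by (auto simp: first_return_def dyck_paths_iff)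
  qed
  show "(\<lambda>(i, a, b). first_return a b) ` (SIGMA i:{..n}. dyck_paths i \<times> dyck_paths (n - i)) =
      dyck_paths (Suc n)"
  proof (intro equalityI subsetI)
    fix w
    assume w: "w \<in> dyck_paths (Suc n)"
    then obtain a b where ab: "dyck a" "dyck b" "w = first_return a b"
      by (metis dyck_paths_iff first_return_exists length_0_conv mult_eq_0_iff nat.simps(3) zero_neq_numeral)
    obtain i j where "length a = 2 * i" "length b = 2 * j"
      using ab dyck_even_length by (metis evenE)
    moreover from this have "i + j = n"
      using w ab(3) by (simp add: dyck_paths_iff first_return_def)
    ultimately have "(i, a, b) \<in> (SIGMA i:{..n}. dyck_paths i \<times> dyck_paths (n - i))"
      using ab by (auto simp: dyck_paths_iff)
    then show "w \<in> (\<lambda>(i, a, b). first_return a b) `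
        (SIGMA i:{..n}. dyck_paths i \<times> dyck_paths (n - i))"
      using ab(3) by force
  qed (auto simp: dyck_paths_iff dyck_first_return, simp add: first_return_def)
qed

lemma dyck_paths_0 [simp]: "dyck_paths 0 = {[]}"
  by (auto simp: dyck_paths_iff)

section \<open>Peak and hook counts under the first-return decomposition\<close>

lemma occurrences_Nil: "p \<noteq> [] \<Longrightarrow> occurrences p [] = 0"
  by (simp add: occurrences_def)

text \<open>Occurrences in the tail are shifted by one position, and position 0 is tested
  separately. This makes both statistics accessible to induction on the word.\<close>

lemma occurrences_Cons:
  assumes "p \<noteq> []"
  shows "occurrences p (x # w) =
    occurrences p w + (if take (length p) (x # w) = p then 1 else 0)"
proof -
  define S where "S = (\<lambda>w. {i. i + length p \<le> length w \<and> take (length p) (drop i w) = p})"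
  have fin: "finite (S v)" for v
    by (rule finite_subset [of _ "{..length v}"]) (auto simp: S_def)
  have len: "length p \<le> length v" if "take (length p) v = p" for v
    using that by (metis length_take min.cobounded1)
  have "S (x # w) = Suc ` S w \<union> (if take (length p) (x # w) = p then {0} else {})"
  proof (intro set_eqI)
    fix i
    show "i \<in> S (x # w) \<longleftrightarrow> i \<in> Suc ` S w \<union> (if take (length p) (x # w) = p then {0} else {})"
      using len [of "x # w"] by (cases i) (auto simp: S_def)
  qed
  then have "card (S (x # w)) =
      card (Suc ` S w) + card (if take (length p) (x # w) = p then {0 :: nat} else {})"
    using fin by (simp add: card_Un_disjoint)
  also have "card (Suc ` S w) = card (S w)"
    by (rule card_image) simp
  finally show ?thesis
    by (simp add: occurrences_def S_def)
qed

lemma pk_Nil [simp]: "pk [] = 0" and hk_Nil [simp]: "hk [] = 0"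
  by (simp_all add: pk_def hk_def occurrences_Nil)

lemma pk_Cons: "pk (x # w) = pk w + (if x = Up \<and> w \<noteq> [] \<and> hd w = Down then 1 else 0)"
  unfolding pk_def by (cases w) (auto simp: occurrences_Cons)

lemma hk_Cons: "hk (x # w) = hk w + (if x = Down \<and> take 2 w = [Down, Up] then 1 else 0)"
  unfolding hk_def by (auto simp: occurrences_Cons numeral_eq_Suc)

text \<open>The inserted down step starts no peak, and it ends one only after an up step, which the
  assumption on \<open>a\<close> excludes.\<close>

lemma pk_append_Down: "a = [] \<or> last a = Down \<Longrightarrow> pk (a @ Down # b) = pk a + pk b"
proof (induction a)
  case (Cons x a)
  then show ?case by (cases a) (auto simp: pk_Cons)
qed (simp add: pk_Cons)

text \<open>The only hook that can straddle the junction consists of the last step of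
  \<open>a\<close>, the inserted step and the first step of \<open>b\<close>.\<close>

lemma hk_append_Down:
  "a \<noteq> [] \<Longrightarrow> last a = Down \<Longrightarrow> b = [] \<or> hd b = Up \<Longrightarrow>
    hk (a @ Down # b) = hk a + hk b + (if b = [] then 0 else 1)"
proof (induction a)
  case (Cons x a)
  show ?case
  proof (cases a)
    case Nil
    with Cons.prems show ?thesis by (cases b) (auto simp: hk_Cons numeral_eq_Suc)
  next
    case (Cons z c)
    with Cons.IH Cons.prems show ?thesis
      by (cases c) (auto simp: hk_Cons numeral_eq_Suc)
  qed
qed simp

lemma pk_first_return:
  assumes "dyck a" "dyck b"
  shows "pk (first_return a b) = pk a + pk b + (if a = [] then 1 else 0)"
  using pk_append_Down [of a b] dyck_last [OF assms(1)] dyck_hd [OF assms(1)]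
  by (cases a) (auto simp: first_return_def pk_Cons)

text \<open>If \<open>a\<close> is empty, \<open>b\<close> is preceded by UD, so no hook ends at its
  first step.\<close>

lemma hk_first_return:
  assumes "dyck a" "dyck b"
  shows "hk (first_return a b) = hk a + hk b + (if a = [] \<or> b = [] then 0 else 1)"
  using hk_append_Down [of a b] dyck_last [OF assms(1)] dyck_hd [OF assms(2)]
  by (cases a; cases b) (auto simp: first_return_def hk_Cons numeral_eq_Suc)

text \<open>The exponent \<open>hk \<mu> + 1\<close> makes the weight multiplicative when both
  factors are nonempty: the new hook supplies the second extra y. An empty inner factor contributes
  t, an empty outer factor 1; for \<open>n = 0\<close> these two cases coincide.\<close>

lemma dyck_poly_Suc:
  fixes y t :: "'a::comm_ring_1"
  shows "dyck_poly (Suc n) y t = (if n = 0 then y * t else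
    (1 + t) * dyck_poly n y t + (\<Sum>i=1..<n. dyck_poly i y t * dyck_poly (n - i) y t))"
proof -
  define wt :: "step list \<Rightarrow> 'a" where "wt = (\<lambda>\<mu>. y ^ (hk \<mu> + 1) * t ^ pk \<mu>)"
  define T where "T = (\<lambda>i. \<Sum>a\<in>dyck_paths i. \<Sum>b\<in>dyck_paths (n - i). wt (first_return a b))"
  have D: "dyck_poly m y t = (\<Sum>a\<in>dyck_paths m. wt a)" for m
    by (simp add: dyck_poly_def wt_def)
  have "dyck_poly (Suc n) y t =
      (\<Sum>(i, a, b)\<in>(SIGMA i:{..n}. dyck_paths i \<times> dyck_paths (n - i)). wt (first_return a b))"
    unfolding D sum.reindex_bij_betw [OF bij_betw_first_return, symmetric]
    by (simp add: case_prod_unfold)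
  also have "\<dots> = sum T {..n}"
    unfolding T_def sum.cartesian_product
    by (subst sum.Sigma) (simp_all add: finite_dyck_paths case_prod_unfold)
  finally have rec: "dyck_poly (Suc n) y t = sum T {..n}" .
  have nonempty: "a \<noteq> []" "dyck a" if "a \<in> dyck_paths i" "i > 0" for a i
    using that by (auto simp: dyck_paths_iff)
  show ?thesis
  proof (cases "n = 0")
    case True
    then show ?thesis
      using rec pk_first_return [of "[]" "[]"] hk_first_return [of "[]" "[]"]
      by (simp add: T_def wt_def)
  next
    case False
    have "T 0 = t * dyck_poly n y t"
      unfolding T_def D sum_distrib_left
      using False by (auto intro!: sum.cong simp: wt_def pk_first_return hk_first_return dyck_paths_iff)
    moreover have "T n = dyck_poly n y t"
      unfolding T_def D
      using False nonempty by (auto intro!: sum.cong simp: wt_def pk_first_return hk_first_return)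
    moreover have "T i = dyck_poly i y t * dyck_poly (n - i) y t" if "i \<in> {1..<n}" for i
    proof -
      have "wt (first_return a b) = wt a * wt b"
        if "a \<in> dyck_paths i" "b \<in> dyck_paths (n - i)" for a b
        using nonempty [OF that(1)] nonempty [OF that(2)] \<open>i \<in> {1..<n}\<close>
        by (simp add: wt_def pk_first_return hk_first_return power_add mult_ac)
      then show ?thesis
        unfolding T_def D sum_product by (intro sum.cong refl)
    qed
    moreover have "{..n} = insert 0 (insert n {1..<n})" using False by auto
    ultimately show ?thesis
      using False rec by (simp add: algebra_simps)
  qed
qed

section \<open>Closed formula and Narayana polynomials\<close>

text \<open>For n >= 1 this is \<open>a\<close> times the generating polynomial of Motzkin paths of
  length n-1, with weight \<open>a\<close> per up step and \<open>b\<close> per level step. Terms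
  with 2k > n-1 vanish.\<close>

definition motzkin_poly :: "nat \<Rightarrow> 'a::field_char_0 \<Rightarrow> 'a \<Rightarrow> 'a" where
  "motzkin_poly n a b =
    (\<Sum>k\<le>n. catalan k * of_nat ((n - 1) choose (2 * k)) * a ^ (k + 1) * b ^ (n - 1 - 2 * k))"

lemma motzkin_poly_truncate:
  assumes "n \<ge> 1"
  shows "motzkin_poly n a b = (\<Sum>k = 0..(n - 1) div 2.
    catalan k * of_nat ((n - 1) choose (2 * k)) * a ^ (k + 1) * b ^ (n - 1 - 2 * k))"
  unfolding motzkin_poly_def using assms
  by (intro sum.mono_neutral_right) (auto simp: binomial_eq_0)

text \<open>Every term is homogeneous of weight 2(k+1) + (n-1-2k) = n+1. The sum is truncated first
  because this count fails once the subtraction truncates.\<close>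

lemma motzkin_poly_scale:
  assumes "n \<ge> 1"
  shows "motzkin_poly n (c ^ 2 * a) (c * b) = c ^ (n + 1) * motzkin_poly n a b"
  unfolding motzkin_poly_truncate [OF assms] sum_distrib_left
proof (intro sum.cong refl)
  fix k
  assume "k \<in> {0..(n - 1) div 2}"
  then have "n + 1 = 2 * (k + 1) + (n - 1 - 2 * k)" using assms by auto
  then have "c ^ (n + 1) = (c ^ 2) ^ (k + 1) * c ^ (n - 1 - 2 * k)"
    by (metis power_add power_mult)
  then show "catalan k * of_nat ((n - 1) choose (2 * k)) * (c ^ 2 * a) ^ (k + 1) * (c * b) ^ (n - 1 - 2 * k) =
      c ^ (n + 1) * (catalan k * of_nat ((n - 1) choose (2 * k)) * a ^ (k + 1) * b ^ (n - 1 - 2 * k))"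
    by (simp only: power_mult_distrib mult_ac)
qed

lemma dyck_poly_eq_motzkin_poly:
  fixes y t :: "'a::field_char_0"
  assumes "n \<ge> 1"
  shows "dyck_poly n y t = motzkin_poly n (y * t) (1 + t)"
proof -
  \<comment> \<open>The constant term is 0 rather than \<open>dyck_poly 0 y t\<close>, which is y:
    decompositions with exactly one empty factor are already recorded by (1 + t) G and must not
    reappear in G^2.\<close>
  define G where "G = Abs_fps (\<lambda>n. if n = 0 then 0 else dyck_poly n y t)"
  have "G = fps_X * (fps_const (y * t) + fps_const (1 + t) * G + G ^ 2)"
  proof (rule fps_ext)
    fix m
    show "G $ m = (fps_X * (fps_const (y * t) + fps_const (1 + t) * G + G ^ 2)) $ m"
    proof (cases m)
      case (Suc n)
      have "(G ^ 2) $ n = (\<Sum>i=0..n. G $ i * G $ (n - i))"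
        by (simp add: power2_eq_square fps_mult_nth)
      also have "\<dots> = (\<Sum>i=1..<n. G $ i * G $ (n - i))"
        by (intro sum.mono_neutral_right) (auto simp: G_def)
      also have "\<dots> = (\<Sum>i=1..<n. dyck_poly i y t * dyck_poly (n - i) y t)"
        by (intro sum.cong) (auto simp: G_def)
      finally show ?thesis
        using Suc dyck_poly_Suc [of n y t] by (simp add: G_def)
    qed (simp add: G_def)
  qed
  from quadratic_fps_nth [OF this assms] show ?thesis
    using assms by (simp add: G_def motzkin_poly_def)
qed

text \<open>The binomial theorem with j = i+k+1, padded to a range of j independent of k so that
  sums over k and j can be exchanged. Without the guard, j <= k would give a binomial coefficient 1
  by truncation.\<close>

lemma power_mult_binomial_shift:
  fixes t :: "'a::comm_ring_1"
  assumes "2 * k < n"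
  shows "t ^ (k + 1) * (1 + t) ^ (n - 1 - 2 * k) =
    (\<Sum>j=1..n. of_nat (if k < j then (n - 1 - 2 * k) choose (j - 1 - k) else 0) * t ^ j)"
proof -
  define m where "m = n - 1 - 2 * k"
  have "t ^ (k + 1) * (1 + t) ^ m = (\<Sum>i\<le>m. of_nat (m choose i) * t ^ (i + (k + 1)))"
    using binomial_ring [of t 1 m]
    by (simp add: sum_distrib_left add.commute power_add mult_ac)
  also have "\<dots> = (\<Sum>j\<in>{k+1..m+(k+1)}. of_nat (m choose (j - 1 - k)) * t ^ j)"
    by (rule sum.reindex_bij_witness [of _ "\<lambda>j. j - (k + 1)" "\<lambda>i. i + (k + 1)"]) auto
  also have "\<dots> = (\<Sum>j\<in>{k+1..m+(k+1)}. of_nat (if k < j then m choose (j - 1 - k) else 0) * t ^ j)"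
    by (intro sum.cong) auto
  also have "\<dots> = (\<Sum>j=1..n. of_nat (if k < j then m choose (j - 1 - k) else 0) * t ^ j)"
    using assms by (intro sum.mono_neutral_left) (auto simp: m_def not_le binomial_eq_0)
  finally show ?thesis by (simp only: m_def)
qed

lemma motzkin_poly_expand:
  fixes y t :: "'a::field_char_0"
  assumes "n \<ge> 1"
  shows "motzkin_poly n (y * t) (1 + t) = (\<Sum>k\<le>n. \<Sum>j=1..n.
    catalan k * of_nat ((n - 1) choose (2 * k)) *
    of_nat (if k < j then (n - 1 - 2 * k) choose (j - 1 - k) else 0) * y ^ (k + 1) * t ^ j)"
  unfolding motzkin_poly_def
proof (intro sum.cong refl)
  fix k
  show "catalan k * of_nat ((n - 1) choose (2 * k)) * (y * t) ^ (k + 1) * (1 + t) ^ (n - 1 - 2 * k) =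
    (\<Sum>j=1..n. catalan k * of_nat ((n - 1) choose (2 * k)) *
    of_nat (if k < j then (n - 1 - 2 * k) choose (j - 1 - k) else 0) * y ^ (k + 1) * t ^ j)"
  proof (cases "2 * k < n")
    case True
    have "catalan k * of_nat ((n - 1) choose (2 * k)) * (y * t) ^ (k + 1) * (1 + t) ^ (n - 1 - 2 * k) =
        catalan k * of_nat ((n - 1) choose (2 * k)) * y ^ (k + 1) * (t ^ (k + 1) * (1 + t) ^ (n - 1 - 2 * k))"
      by (simp only: power_mult_distrib mult_ac)
    then show ?thesis
      unfolding power_mult_binomial_shift [OF True] sum_distrib_left
      by (simp only: mult_ac)
  next
    case False
    then have "(n - 1) choose (2 * k) = 0"
      using assms by (intro binomial_eq_0) auto
    then show ?thesis
      by (simp only: of_nat_0 mult_zero_left mult_zero_right sum.neutral_const)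
  qed
qed

text \<open>For i+k <= m both sides equal m! / (k! (k+1)! (i-k)! (m-i-k)!); otherwise both vanish.
  The right side confines k to two factors that Vandermonde can sum.\<close>

lemma catalan_mult_trinomial:
  assumes "k \<le> i" "i \<le> m"
  shows "catalan k * of_nat (m choose (2 * k)) * of_nat ((m - 2 * k) choose (i - k)) =
    (1 / of_nat (m + 1) * of_nat ((m + 1) choose i) *
      of_nat ((i choose k) * ((m + 1 - i) choose (k + 1))) :: 'a::field_char_0)"
proof (cases "i + k \<le> m")
  case True
  with assms have le: "2 * k \<le> m" "i - k \<le> m - 2 * k" "i \<le> m + 1" "k + 1 \<le> m + 1 - i" "k \<le> 2 * k"
    by auto
  have eqs: "m - 2 * k - (i - k) = m - i - k" "m + 1 - i - (k + 1) = m - i - k" "2 * k - k = k"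
    using assms by auto
  have "(of_nat (k + 1) :: 'a) \<noteq> 0" "(of_nat (m + 1) :: 'a) \<noteq> 0"
    unfolding of_nat_eq_0_iff by auto
  moreover have "(fact (m + 1) :: 'a) = of_nat (m + 1) * fact m" "(fact (k + 1) :: 'a) = of_nat (k + 1) * fact k"
    by simp_all
  ultimately show ?thesis
    unfolding catalan_def of_nat_mult
      binomial_fact [OF le(1)] binomial_fact [OF le(2)] binomial_fact [OF le(3)]
      binomial_fact [OF le(4)] binomial_fact [OF le(5)] binomial_fact [OF assms(1)] eqs
    by (simp add: field_simps del: of_nat_Suc of_nat_add)
next
  case False
  then have "m < 2 * k \<or> m - 2 * k < i - k" "m + 1 - i < k + 1" by auto
  then show ?thesis by (auto simp: binomial_eq_0)
qed

text \<open>Vandermonde after reflecting \<open>i choose k\<close>; its term l = 0 vanishes because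
  \<open>i choose Suc i\<close> is 0, and l = k+1 remains.\<close>

lemma sum_binomial_mult_shift:
  assumes "i \<le> n"
  shows "(\<Sum>k\<le>i. (i choose k) * ((n - i) choose (k + 1))) = n choose (i + 1)"
proof -
  have "n choose (i + 1) = (\<Sum>l\<le>Suc i. ((n - i) choose l) * (i choose (Suc i - l)))"
    using vandermonde [of "n - i" i "Suc i"] assms by simp
  also have "\<dots> = (\<Sum>k\<le>i. ((n - i) choose (Suc k)) * (i choose (i - k)))"
    by (subst sum.atMost_Suc_shift) simp
  also have "\<dots> = (\<Sum>k\<le>i. (i choose k) * ((n - i) choose (k + 1)))"
    by (intro sum.cong refl) (simp add: binomial_symmetric [symmetric])
  finally show ?thesis by simp
qed

lemma narayana_poly_eq_motzkin_poly:
  fixes t :: "'a::field_char_0"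
  assumes "n \<ge> 1"
  shows "narayana_poly n t = motzkin_poly n t (1 + t)"
proof -
  have coeff: "(\<Sum>k\<le>n. catalan k * of_nat ((n - 1) choose (2 * k)) *
      of_nat (if k < j then (n - 1 - 2 * k) choose (j - 1 - k) else 0)) =
      (1 / of_nat n * (of_nat (n choose j) * of_nat (n choose (j - 1))) :: 'a)"
    if j: "j \<in> {1..n}" for j
  proof -
    define m i where "m = n - 1" and "i = j - 1"
    then have m: "n = m + 1" and i: "j = i + 1" "i \<le> m"
      using j by auto
    have "(\<Sum>k\<le>n. catalan k * of_nat ((n - 1) choose (2 * k)) *
        of_nat (if k < j then (n - 1 - 2 * k) choose (j - 1 - k) else 0)) =
        (\<Sum>k\<le>i. catalan k * of_nat (m choose (2 * k)) * of_nat ((m - 2 * k) choose (i - k)) :: 'a)"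
      \<comment> \<open>The guard removes exactly the terms with k > i.\<close>
      using m i by (intro sum.mono_neutral_cong_right) auto
    also have "\<dots> = (\<Sum>k\<le>i. 1 / of_nat (m + 1) * of_nat ((m + 1) choose i) *
        of_nat ((i choose k) * ((m + 1 - i) choose (k + 1))))"
      using i by (intro sum.cong refl catalan_mult_trinomial) auto
    also have "\<dots> = 1 / of_nat (m + 1) * of_nat ((m + 1) choose i) * of_nat ((m + 1) choose (i + 1))"
      using sum_binomial_mult_shift [of i "m + 1"] i
      by (simp only: sum_distrib_left [symmetric] of_nat_sum [symmetric])
    finally show ?thesis using m i by (simp only: mult_ac add_diff_cancel_right')
  qed
  have "motzkin_poly n t (1 + t) = (\<Sum>j=1..n. (\<Sum>k\<le>n. catalan k * of_nat ((n - 1) choose (2 * k)) *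
      of_nat (if k < j then (n - 1 - 2 * k) choose (j - 1 - k) else 0)) * t ^ j)"
    \<comment> \<open>Setting y = 1 forgets hooks and leaves the coefficient of each power of t as a
      sum over k.\<close>
    using motzkin_poly_expand [OF assms, of 1 t]
    by (subst (asm) sum.swap) (simp add: sum_distrib_right)
  also have "\<dots> = (\<Sum>j=1..n. 1 / of_nat n * (of_nat (n choose j) * of_nat (n choose (j - 1))) * t ^ j)"
    using coeff by (intro sum.cong refl) simp
  also have "\<dots> = narayana_poly n t"
    by (simp add: narayana_poly_def sum_distrib_left mult_ac)
  finally show ?thesis by simp
qed

text \<open>Both sides are M_n(c^2 x, c (1+x)), by homogeneity and the two preceding
  identifications.\<close>

lemma dyck_poly_eq_narayana_poly:
  fixes y t :: "'a::field_char_0"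
  assumes "n \<ge> 1" "y * t = c ^ 2 * x" "1 + t = c * (1 + x)"
  shows "dyck_poly n y t = c ^ (n + 1) * narayana_poly n x"
  using assms by (simp only: dyck_poly_eq_motzkin_poly narayana_poly_eq_motzkin_poly motzkin_poly_scale)

section \<open>Joint distribution of hooks and peaks\<close>

text \<open>At the indeterminates of Q[y][t] each path contributes one monomial; the outer
  coefficient belongs to t, the inner one to y, shifted by the 1 in
  \<open>hk \<mu> + 1\<close>.\<close>

lemma coeff_dyck_poly:
  "coeff (coeff (dyck_poly n [:[:0, 1:]:] [:0, 1:] :: rat poly poly) j) (k + 1) =
    of_nat (card {\<mu> \<in> dyck_paths n. hk \<mu> = k \<and> pk \<mu> = j})"
proof -
  have mon: "[:[:0, 1:]:] ^ a * [:0, 1:] ^ b = monom (monom 1 a) b" for a b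
    by (simp add: monom_altdef poly_const_pow)
  have "coeff (coeff (dyck_poly n [:[:0, 1:]:] [:0, 1:] :: rat poly poly) j) (k + 1) =
      (\<Sum>\<mu>\<in>dyck_paths n. if hk \<mu> = k \<and> pk \<mu> = j then 1 else 0)"
    unfolding dyck_poly_def mon coeff_sum by (intro sum.cong refl) auto
  also have "\<dots> = of_nat (card {\<mu> \<in> dyck_paths n. hk \<mu> = k \<and> pk \<mu> = j})"
    using finite_dyck_paths by (simp add: sum.If_cases Int_def)
  finally show ?thesis .
qed

lemma to_fract_power: "to_fract (x ^ n) = to_fract x ^ n"
  by (induction n) auto

lemma to_fract_of_nat: "to_fract (of_nat n) = of_nat n"
  by (induction n) auto

lemma catalan_rat_eq_to_fract: "(catalan k :: rat poly poly fract) = to_fract [:[:catalan k:]:]"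
proof -
  have "of_nat (k + 1) * [:[:catalan k :: rat:]:] = of_nat (2 * k choose k)"
    by (simp add: of_nat_poly catalan_def del: of_nat_Suc of_nat_add)
  then have "of_nat (k + 1) * to_fract [:[:catalan k :: rat:]:] = of_nat (2 * k choose k)"
    by (metis to_fract_mult to_fract_of_nat)
  moreover have "(of_nat (k + 1) :: rat poly poly fract) \<noteq> 0"
    unfolding of_nat_eq_0_iff by simp
  ultimately show ?thesis
    unfolding catalan_def by (simp add: field_simps del: of_nat_Suc of_nat_add)
qed

text \<open>The closed formula is available only over a field, whereas coefficients are read off in
  Q[y][t]; the proof passes through the fraction field and back by injectivity of
  \<open>to_fract\<close>.\<close>

lemma card_hk_pk:
  assumes "n \<ge> 1"
  shows "of_nat (card {\<mu> \<in> dyck_paths n. hk \<mu> = k \<and> pk \<mu> = j}) =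
    (catalan k * of_nat ((n - 1) choose (2 * k)) *
      of_nat (if k < j then (n - 1 - 2 * k) choose (j - 1 - k) else 0) :: rat)"
proof -
  define c :: "nat \<Rightarrow> nat \<Rightarrow> rat" where "c = (\<lambda>k j. catalan k * of_nat ((n - 1) choose (2 * k)) *
      of_nat (if k < j then (n - 1 - 2 * k) choose (j - 1 - k) else 0))"
  have "to_fract (dyck_poly n [:[:0, 1:]:] [:0, 1:]) = dyck_poly n rat_y rat_t"
    unfolding dyck_poly_def rat_y_def rat_t_def
    by (simp only: to_fract_sum to_fract_mult to_fract_power)
  also have "\<dots> = (\<Sum>k\<le>n. \<Sum>j=1..n. catalan k * of_nat ((n - 1) choose (2 * k)) *
      of_nat (if k < j then (n - 1 - 2 * k) choose (j - 1 - k) else 0) * rat_y ^ (k + 1) * rat_t ^ j)"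
    by (simp only: dyck_poly_eq_motzkin_poly [OF assms] motzkin_poly_expand [OF assms])
  also have "\<dots> = to_fract (\<Sum>k\<le>n. \<Sum>j=1..n. [:[:catalan k:]:] * of_nat ((n - 1) choose (2 * k)) *
      of_nat (if k < j then (n - 1 - 2 * k) choose (j - 1 - k) else 0) *
      [:[:0, 1:]:] ^ (k + 1) * [:0, 1:] ^ j)"
    unfolding rat_y_def rat_t_def
    by (simp only: to_fract_sum to_fract_mult to_fract_power to_fract_of_nat catalan_rat_eq_to_fract)
  also have "\<dots> = to_fract (\<Sum>k\<le>n. \<Sum>j=1..n. monom (monom (c k j) (k + 1)) j)"
  proof -
    have "[:[:a:]:] * of_nat p * of_nat q * [:[:0, 1:]:] ^ r * [:0, 1:] ^ s =
        monom (monom (a * of_nat p * of_nat q) r) s" for a :: rat and p q r s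
      by (simp add: monom_altdef poly_const_pow of_nat_poly)
    then show ?thesis by (simp only: c_def)
  qed
  finally have "dyck_poly n [:[:0, 1:]:] [:0, 1:] = (\<Sum>k\<le>n. \<Sum>j=1..n. monom (monom (c k j) (k + 1)) j)"
    by (simp only: to_fract_eq_iff)
  then have "of_nat (card {\<mu> \<in> dyck_paths n. hk \<mu> = k \<and> pk \<mu> = j}) =
      coeff (coeff (\<Sum>k\<le>n. \<Sum>j=1..n. monom (monom (c k j) (k + 1)) j) j) (k + 1)"
    by (metis coeff_dyck_poly)
  also have "\<dots> = (\<Sum>k'\<le>n. \<Sum>j'=1..n. if j' = j then if k' = k then c k j else 0 else 0)"
    unfolding coeff_sum by (intro sum.cong refl) auto
  also have "\<dots> = (if k \<le> n \<and> j \<in> {1..n} then c k j else 0)"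
    by (cases "1 \<le> j"; cases "j \<le> n") (simp_all add: sum.delta)
  \<comment> \<open>Outside the summation range the guard or a binomial coefficient already makes
    \<open>c k j\<close> zero.\<close>
  also have "\<dots> = c k j"
  proof (cases "2 * k \<le> n - 1")
    case True
    then show ?thesis using assms by (auto simp: c_def intro!: binomial_eq_0)
  next
    case False
    then show ?thesis by (simp add: c_def binomial_eq_0)
  qed
  finally show ?thesis by (simp only: c_def)
qed

section \<open>The series u and v\<close>

text \<open>The factor theorem applied coefficientwise, with a shift that removes
  \<open>fps_X\<close>. It clears the denominators of \<open>ser_u\<close> and
  \<open>ser_v\<close>.\<close>

lemma poly_fps_divide:
  fixes f :: "rat poly fps"
  assumes "f $ 0 = 0" "\<And>n. poly (f $ n) c = 0"
  obtains g where "f = 2 * fps_const [:-c, 1:] * fps_X * g"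
proof -
  define g where "g = Abs_fps (\<lambda>n. smult (1/2) (f $ Suc n div [:-c, 1:]))"
  have "f = 2 * fps_const [:-c, 1:] * fps_X * g"
  proof (rule fps_ext)
    fix n
    have "f $ n = [:-c, 1:] * (f $ n div [:-c, 1:])"
      using assms(2) [of n] by (metis dvd_mult_div_cancel poly_eq_0_iff_dvd)
    then show "f $ n = (2 * fps_const [:-c, 1:] * fps_X * g) $ n"
      using assms(1)
      by (cases n) (auto simp: g_def mult.assoc numeral_fps_const numeral_poly smult_diff_right)
  qed
  then show thesis using that by blast
qed

text \<open>Specialisation of y to \<open>c\<close>; the rules below make it a ring homomorphism
  fixing \<open>fps_X\<close>.\<close>

definition fps_eval :: "'a::comm_ring_1 \<Rightarrow> 'a poly fps \<Rightarrow> 'a fps" where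
  "fps_eval c f = Abs_fps (\<lambda>n. poly (f $ n) c)"

lemma fps_eval_simps [simp]:
  "fps_eval c (f + g) = fps_eval c f + fps_eval c g"
  "fps_eval c (f - g) = fps_eval c f - fps_eval c g"
  "fps_eval c (f * g) = fps_eval c f * fps_eval c g"
  "fps_eval c (fps_const p) = fps_const (poly p c)"
  "fps_eval c fps_X = fps_X"
  "fps_eval c 1 = 1"
  "fps_eval c (numeral k) = numeral k"
  by (auto simp: fps_eval_def fps_eq_iff fps_mult_nth poly_sum fps_numeral_nth)

lemma fps_eval_power [simp]: "fps_eval c (f ^ n) = fps_eval c f ^ n"
  by (induction n) auto

lemma sqrt_series:
  "sqrt_series ^ 2 = (1 + fps_X) ^ 2 - 4 * fps_const [:0, 1:] * fps_X" "sqrt_series $ 0 = 1"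
  using theI' [OF sqrt_series_exists_unique] unfolding sqrt_series_def by blast+

lemma fps_square_unique:
  fixes f g :: "'a::{idom, ring_char_0} fps"
  assumes "f ^ 2 = g ^ 2" "f $ 0 = 1" "g $ 0 = 1"
  shows "f = g"
proof -
  have "f \<noteq> - g"
  proof
    assume "f = - g"
    then have "f $ 0 = - (g $ 0)" by simp
    with assms show False by simp
  qed
  with assms(1) show ?thesis by (auto simp: power2_eq_iff)
qed

text \<open>The radicand specialises to (1+t)^2 at y = 0 and to (1-t)^2 at y = 1; the constant term
  1 fixes the sign of the root.\<close>

lemma fps_eval_sqrt_series:
  "fps_eval 0 sqrt_series = 1 + fps_X" "fps_eval 1 sqrt_series = 1 - fps_X"
proof -
  have c: "fps_eval c sqrt_series $ 0 = 1" for c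
    using sqrt_series(2) by (simp add: fps_eval_def)
  have sq: "fps_eval c sqrt_series ^ 2 = (1 + fps_X) ^ 2 - 4 * fps_const c * fps_X" for c
    using arg_cong [OF sqrt_series(1), of "fps_eval c"] by simp
  show "fps_eval 0 sqrt_series = 1 + fps_X"
    by (rule fps_square_unique) (simp_all add: sq c)
  show "fps_eval 1 sqrt_series = 1 - fps_X"
    by (rule fps_square_unique)
      (simp_all add: sq c, simp add: power2_eq_square algebra_simps numeral_fps_const)
qed

text \<open>These are, in order, the hypotheses of \<open>sqrt_parametrization\<close> for the
  series.\<close>

lemma ser_basic:
  "ser_t \<noteq> 0" "ser_y \<noteq> 0" "ser_y \<noteq> 1" "ser_sqrt \<noteq> 0" "1 + ser_t \<noteq> 0"
  "ser_sqrt ^ 2 = (1 + ser_t) ^ 2 - 4 * ser_y * ser_t"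
proof -
  have num: "to_fract 4 = (4 :: rat poly fps fract)"
    using to_fract_of_nat [of 4, where 'a = "rat poly fps"] by simp
  show "ser_t \<noteq> 0" by (simp add: ser_t_def)
  show "ser_y \<noteq> 0" by (simp add: ser_y_def)
  show "ser_y \<noteq> 1"
    unfolding ser_y_def to_fract_1 [symmetric] to_fract_eq_iff
    by (simp add: fps_eq_iff one_pCons)
  have "ser_sqrt ^ 2 = to_fract ((1 + fps_X) ^ 2 - 4 * fps_const [:0, 1:] * fps_X)"
    unfolding ser_sqrt_def sqrt_series(1) [symmetric] by (simp add: to_fract_power)
  then show "ser_sqrt ^ 2 = (1 + ser_t) ^ 2 - 4 * ser_y * ser_t"
    by (simp add: ser_t_def ser_y_def to_fract_power num)
  have "(1 + fps_X :: rat poly fps) $ 0 \<noteq> 0" by simp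
  then show "1 + ser_t \<noteq> 0"
    unfolding ser_t_def to_fract_1 [symmetric] to_fract_add [symmetric] to_fract_eq_0_iff
    by (metis fps_zero_nth)
  show "ser_sqrt \<noteq> 0"
    using sqrt_series(2) by (auto simp: ser_sqrt_def)
qed

text \<open>
  Divisibility of the numerators by \<open>y\<close>, respectively by \<open>1 - y\<close>, is their vanishing at \<open>y = 0\<close>,
  respectively at \<open>y = 1\<close>, where the square root becomes \<open>1 + t\<close>, respectively \<open>1 - t\<close>.
\<close>

lemma ser_v_in_range: "ser_v \<in> range to_fract"
proof -
  define N where "N = (1 + fps_X) ^ 2 - 2 * fps_const [:0, 1:] * fps_X - (1 + fps_X) * sqrt_series"
  have num: "to_fract 2 = (2 :: rat poly fps fract)"
    using to_fract_of_nat [of 2, where 'a = "rat poly fps"] by simp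
  have "fps_eval 0 N = 0"
    by (simp add: N_def fps_eval_sqrt_series power2_eq_square)
  then have "poly (N $ n) 0 = 0" for n
    by (simp add: fps_eval_def fps_eq_iff)
  moreover have "N $ 0 = 0"
    using sqrt_series(2) by (simp add: N_def power2_eq_square mult.assoc)
  ultimately obtain g where g: "N = 2 * fps_const [:-0, 1:] * fps_X * g"
    using poly_fps_divide [of N 0] by blast
  have "ser_v = to_fract N / (2 * ser_y * ser_t)"
    by (simp add: ser_v_def N_def ser_y_def ser_t_def ser_sqrt_def num to_fract_power)
  also have "to_fract N = (2 * ser_y * ser_t) * to_fract g"
    by (simp add: g num ser_y_def ser_t_def)
  finally have "ser_v = to_fract g"
    using ser_basic by simp
  then show ?thesis by simp
qed

lemma ser_u_in_range: "ser_u \<in> range to_fract"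
proof -
  define N where "N = 1 + fps_X ^ 2 - 2 * fps_const [:0, 1:] * fps_X - (1 - fps_X) * sqrt_series"
  have num: "to_fract 2 = (2 :: rat poly fps fract)"
    using to_fract_of_nat [of 2, where 'a = "rat poly fps"] by simp
  have "fps_eval 1 N = 0"
    by (simp add: N_def fps_eval_sqrt_series power2_eq_square algebra_simps)
  then have "poly (N $ n) 1 = 0" for n
    by (simp add: fps_eval_def fps_eq_iff)
  moreover have "N $ 0 = 0"
    using sqrt_series(2) by (simp add: N_def power2_eq_square mult.assoc)
  ultimately obtain g where g: "N = 2 * fps_const [:-1, 1:] * fps_X * g"
    using poly_fps_divide [of N 1] by blast
  have y1: "to_fract (fps_const [:-1, 1:]) = ser_y - 1"
    unfolding ser_y_def to_fract_1 [symmetric] to_fract_diff [symmetric] to_fract_eq_iff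
    by (simp add: fps_eq_iff one_pCons)
  have "ser_u = to_fract N / (2 * (1 - ser_y) * ser_t)"
    by (simp add: ser_u_def N_def ser_y_def ser_t_def ser_sqrt_def num to_fract_power)
  \<comment> \<open>The factor theorem yields y - 1 where the denominator has 1 - y, hence the sign
    of \<open>g\<close>.\<close>
  also have "to_fract N = (2 * (1 - ser_y) * ser_t) * to_fract (- g)"
    by (simp add: g num y1 algebra_simps flip: ser_t_def)
  finally have "ser_u = to_fract (- g)"
    using ser_basic by simp
  then show ?thesis by (metis rangeI)
qed

text \<open>Modulo the equation for s, the quantities 1+u, 1+v and 1+uv become products of s,
  s-(1-t), 1+t-s and 1+t up to nonzero factors, which gives the second identity. The first follows
  from it and a quadratic equation for v.\<close>

lemma sqrt_parametrization:
  fixes y t s u v :: "'a::field_char_0"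
  assumes nz: "t \<noteq> 0" "y \<noteq> 0" "y \<noteq> 1" "s \<noteq> 0" "1 + t \<noteq> 0" and s: "s ^ 2 = (1 + t) ^ 2 - 4 * y * t"
    and u: "u = (1 + t ^ 2 - 2 * y * t - (1 - t) * s) / (2 * (1 - y) * t)"
    and v: "v = ((1 + t) ^ 2 - 2 * y * t - (1 + t) * s) / (2 * y * t)"
  shows "y * t = ((1 + u) / (1 + u * v)) ^ 2 * v" "1 + t = (1 + u) / (1 + u * v) * (1 + v)"
proof -
  have v': "2 * y * t * v = (1 + t) ^ 2 - 2 * y * t - (1 + t) * s"
    using nz by (simp add: v)
  have u': "2 * (1 - y) * t * u = 1 + t ^ 2 - 2 * y * t - (1 - t) * s"
    using nz by (simp add: u)
  \<comment> \<open>This and the next inequality keep the factors of 1+uv nonzero, so that the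
    quotient is genuine.\<close>
  have s1: "s \<noteq> 1 + t"
  proof
    assume "s = 1 + t"
    then have "4 * y * t = 0" using s by simp
    then show False using nz by simp
  qed
  have s2: "s \<noteq> 1 - t"
  proof
    assume "s = 1 - t"
    then have "4 * t * (y - 1) = 0" using s by algebra
    then show False using nz by simp
  qed
  have v1: "2 * y * t * (1 + v) = (1 + t) * (1 + t - s)"
    using v' by algebra
  have u1: "2 * (1 - y) * t * (1 + u) = s * (s - (1 - t))"
    using u' s by algebra
  have uv: "4 * y * (1 - y) * t ^ 2 * (1 + u * v) = s * (s - (1 - t)) * (1 + t - s)"
    using u' v' s by algebra
  have "4 * y * (1 - y) * t ^ 2 \<noteq> 0" using nz by simp
  moreover have "s * (s - (1 - t)) * (1 + t - s) \<noteq> 0" using nz s1 s2 by simp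
  ultimately have uv0: "1 + u * v \<noteq> 0" using uv by (metis mult_zero_right)
  have "4 * y * (1 - y) * t ^ 2 * ((1 + t) * (1 + u * v)) =
      4 * y * (1 - y) * t ^ 2 * ((1 + u) * (1 + v))"
    using v1 u1 uv by algebra
  then have eq: "(1 + t) * (1 + u * v) = (1 + u) * (1 + v)" using nz by simp
  then show t: "1 + t = (1 + u) / (1 + u * v) * (1 + v)"
    using uv0 by (simp add: field_simps)
  \<comment> \<open>Eliminating s exhibits v as a root of y t (1+v)^2 = v (1+t)^2.\<close>
  have "4 * y * t * (y * t * (1 + v) ^ 2) = 4 * y * t * (v * (1 + t) ^ 2)"
    using v1 v' s by algebra
  then have yt: "y * t * (1 + v) ^ 2 = v * (1 + t) ^ 2" using nz by simp
  define c where "c = (1 + u) / (1 + u * v)"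
  show "y * t = ((1 + u) / (1 + u * v)) ^ 2 * v"
  proof -
    have "(1 + v) ^ 2 * (y * t) = (1 + v) ^ 2 * (c ^ 2 * v)"
      using yt t unfolding c_def [symmetric] by algebra
    moreover have "1 + v \<noteq> 0" using t nz by auto
    ultimately show ?thesis by (simp add: c_def)
  qed
qed

section \<open>Specialisation to rational functions and series\<close>

lemma rat_nonzero: "1 + rat_y \<noteq> 0" "1 + rat_y * rat_t \<noteq> 0" "rat_y + rat_t \<noteq> 0"
  unfolding rat_y_def rat_t_def to_fract_1 [symmetric] to_fract_mult [symmetric]
    to_fract_add [symmetric] to_fract_eq_0_iff
  by (simp_all add: one_pCons)

theorem corollary5p10:
  fixes n :: nat
  assumes "n \<ge> 1"
  shows
    "narayana_poly n rat_t =
       ((1 + rat_y * rat_t) / (1 + rat_y)) ^ (n + 1) *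
       dyck_poly n ((1 + rat_y) ^ 2 * rat_t / ((rat_y + rat_t) * (1 + rat_y * rat_t)))
                   ((rat_y + rat_t) / (1 + rat_y * rat_t))
     \<and> (ser_u \<in> range to_fract \<and> ser_v \<in> range to_fract \<and>
        dyck_poly n ser_y ser_t =
          ((1 + ser_u) / (1 + ser_u * ser_v)) ^ (n + 1) * narayana_poly n ser_v)
     \<and> dyck_poly n rat_y rat_t =
          (\<Sum>k = 0..(n - 1) div 2.
             1 / of_nat (k + 1) * of_nat ((2 * k) choose k) * of_nat ((n - 1) choose (2 * k)) *
             rat_y ^ (k + 1) * rat_t ^ (k + 1) * (1 + rat_t) ^ (n - 2 * k - 1))
     \<and> (\<forall>k j :: nat.
          of_nat (card {\<mu> \<in> dyck_paths n. hk \<mu> = k \<and> pk \<mu> = j}) =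
          1 / of_nat (k + 1) * binom (2 * int k) (int k) * binom (int n - 1) (2 * int k) *
          binom (int n - 2 * int k - 1) (int j - int k - 1))"
proof (intro conjI allI)
  \<comment> \<open>The inverse of the prefactor; the substituted variables satisfy the two
    conditions on c and x with x = t.\<close>
  define c where "c = (1 + rat_y) / (1 + rat_y * rat_t)"
  have c: "((1 + rat_y * rat_t) / (1 + rat_y)) ^ (n + 1) * c ^ (n + 1) = 1"
    using rat_nonzero by (simp add: c_def flip: power_mult_distrib)
  have "dyck_poly n ((1 + rat_y) ^ 2 * rat_t / ((rat_y + rat_t) * (1 + rat_y * rat_t)))
      ((rat_y + rat_t) / (1 + rat_y * rat_t)) = c ^ (n + 1) * narayana_poly n rat_t"
  proof (rule dyck_poly_eq_narayana_poly [OF assms])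
    show "(1 + rat_y) ^ 2 * rat_t / ((rat_y + rat_t) * (1 + rat_y * rat_t)) *
        ((rat_y + rat_t) / (1 + rat_y * rat_t)) = c ^ 2 * rat_t"
      using rat_nonzero by (simp add: c_def power2_eq_square)
    show "1 + (rat_y + rat_t) / (1 + rat_y * rat_t) = c * (1 + rat_t)"
      using rat_nonzero by (simp add: c_def field_simps)
  qed
  then show "narayana_poly n rat_t =
      ((1 + rat_y * rat_t) / (1 + rat_y)) ^ (n + 1) *
      dyck_poly n ((1 + rat_y) ^ 2 * rat_t / ((rat_y + rat_t) * (1 + rat_y * rat_t)))
        ((rat_y + rat_t) / (1 + rat_y * rat_t))"
    using c by (simp only: mult.assoc [symmetric] mult_1_left)
next
  show "ser_u \<in> range to_fract" by (rule ser_u_in_range)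
next
  show "ser_v \<in> range to_fract" by (rule ser_v_in_range)
next
  show "dyck_poly n ser_y ser_t =
      ((1 + ser_u) / (1 + ser_u * ser_v)) ^ (n + 1) * narayana_poly n ser_v"
    by (intro dyck_poly_eq_narayana_poly [OF assms]
        sqrt_parametrization [OF ser_basic ser_u_def ser_v_def])
next
  have "n - 1 - 2 * k = n - 2 * k - 1" for k by simp
  then show "dyck_poly n rat_y rat_t =
      (\<Sum>k = 0..(n - 1) div 2.
        1 / of_nat (k + 1) * of_nat ((2 * k) choose k) * of_nat ((n - 1) choose (2 * k)) *
        rat_y ^ (k + 1) * rat_t ^ (k + 1) * (1 + rat_t) ^ (n - 2 * k - 1))"
    unfolding dyck_poly_eq_motzkin_poly [OF assms] motzkin_poly_truncate [OF assms]
    by (simp only: catalan_def power_mult_distrib mult.assoc)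
next
  fix k j :: nat
  have b1: "binom (2 * int k) (int k) = of_nat ((2 * k) choose k)"
    using binom_of_nat [of "2 * k" k] by simp
  have b2: "binom (int n - 1) (2 * int k) = of_nat ((n - 1) choose (2 * k))"
    using binom_of_nat [of "n - 1" "2 * k"] assms by (simp add: of_nat_diff)
  \<comment> \<open>For larger k the upper argument is negative and the generalised coefficient need
    not agree with the truncated one; there the factor \<open>b2\<close> is zero instead.\<close>
  have b3: "binom (int n - 2 * int k - 1) (int j - int k - 1) =
      of_nat (if k < j then (n - 1 - 2 * k) choose (j - 1 - k) else 0)" if "2 * k \<le> n - 1"
  proof (cases "k < j")
    case True
    have "int n - 2 * int k - 1 = int (n - 1 - 2 * k)" "int j - int k - 1 = int (j - 1 - k)"
      using True that assms by auto
    then show ?thesis using True by (simp only: binom_of_nat if_True)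
  qed (simp add: binom_def)
  show "of_nat (card {\<mu> \<in> dyck_paths n. hk \<mu> = k \<and> pk \<mu> = j}) =
      1 / of_nat (k + 1) * binom (2 * int k) (int k) * binom (int n - 1) (2 * int k) *
      binom (int n - 2 * int k - 1) (int j - int k - 1)"
  proof (cases "2 * k \<le> n - 1")
    case True
    then show ?thesis
      by (simp only: card_hk_pk [OF assms] catalan_def b1 b2 b3)
  next
    case False
    then have "(n - 1) choose (2 * k) = 0" by (intro binomial_eq_0) auto
    then show ?thesis
      by (simp only: card_hk_pk [OF assms] b1 b2 of_nat_0 mult_zero_left mult_zero_right)
  qed
qed

end
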